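(* Let $X \xrightarrow{f} Z \xleftarrow{g} Y$ be continuous maps. Then $$(\mathrm{TC}(f,g)+1)\cdot(\mathrm{sec}(f\times g)+1)\ \ge\ \mathrm{TC}(Z)+1,$$ where $f\times g\colon X\times Y\to Z\times Z$ is the product map.
   Context: All maps are continuous, $I=[0,1]$, and path spaces $X^I$ carry the compact-open topology. For a map $p\colon E\to B$, the sectional number $\mathrm{sec}(p)$ is the least integer $k\ge 0$ such that $B$ has an open cover $U_0,\dots,U_k$ with continuous maps $s_i\colon U_i\to E$ satisfying $p\circ s_i=\mathrm{inc}_{U_i}$ (strict equality); $\mathrm{sec}(p)=\infty$ if no such $k$ exists. For maps $f\colon X\to Z$, $g\colon Y\to Z$ put $\Delta^I_{f,g}=\{(\alpha,\beta)\in X^I\times Y^I : f\circ\alpha=g\circ\beta\}$ and $\pi_{f,g}\colon\Delta^I_{f,g}\to X\times Y$, $\pi_{f,g}(\alpha,\beta)=(\alpha(0),\beta(1))$. The bivariate topological complexity is $\mathrm{TC}(f,g):=\mathrm{sec}(\pi_{f,g})$. For a space $Z$, $\mathrm{TC}(Z)$ is Farber's topological complexity, i.e. the sectional category of the path fibration $\pi_Z\colon Z^I\to Z\times Z$, $\pi_Z(\gamma)=(\gamma(0),\gamma(1))$ (equal to $\mathrm{sec}(\pi_Z)$ since $\pi_Z$ is a Hurewicz fibration). Here the sectional category $\mathrm{secat}(p)$ of a map $p\colon E\to B$ is defined like $\mathrm{sec}(p)$ but requiring only $p\circ s_i\simeq \mathrm{inc}_{U_i}$. *)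

theory Defs
  imports "HOL-Analysis.Analysis" "HOL-Library.Extended_Nat"
begin

text \<open>
  Spaces are abstract topologies, so that arbitrary (possibly empty) spaces are covered.
  A map is a HOL function that matters only on the topspace of its domain; in the function
  space, extensionality picks one representative of each continuous map.
\<close>

definition compact_open_topology :: "'a topology \<Rightarrow> 'b topology \<Rightarrow> ('a \<Rightarrow> 'b) topology" where
  "compact_open_topology X Y = topology_generated_by
     {{h. h \<in> extensional (topspace X) \<and> continuous_map X Y h \<and> h ` K \<subseteq> U} | K U.
        compactin X K \<and> openin Y U}"

lemma topspace_compact_open_topology:
  "topspace (compact_open_topology X Y) =
     {h. h \<in> extensional (topspace X) \<and> continuous_map X Y h}"
  unfolding compact_open_topology_def topology_generated_by_topspace
  by (auto intro!: exI[of _ "{h. h \<in> extensional (topspace X) \<and> continuous_map X Y h}"]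
      exI[of _ "{}"])

abbreviation path_space :: "'a topology \<Rightarrow> (real \<Rightarrow> 'a) topology" where
  "path_space X \<equiv> compact_open_topology (top_of_set {0..1}) X"

text \<open>
  The infimum is taken in \<^typ>\<open>enat\<close>, so it is a minimum if some \<open>k\<close> is admissible, and
  \<open>\<infinity>\<close> otherwise.
\<close>

definition sec :: "'e topology \<Rightarrow> 'b topology \<Rightarrow> ('e \<Rightarrow> 'b) \<Rightarrow> enat" where
  "sec E B p = Inf {enat k | k. \<exists>(U :: nat \<Rightarrow> 'b set) (s :: nat \<Rightarrow> 'b \<Rightarrow> 'e).
     (\<forall>i\<le>k. openin B (U i) \<and>
        continuous_map (subtopology B (U i)) E (s i) \<and>
        (\<forall>b\<in>U i. p (s i b) = b)) \<and>
     (\<Union>i\<le>k. U i) = topspace B}"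

definition secat :: "'e topology \<Rightarrow> 'b topology \<Rightarrow> ('e \<Rightarrow> 'b) \<Rightarrow> enat" where
  "secat E B p = Inf {enat k | k. \<exists>(U :: nat \<Rightarrow> 'b set) (s :: nat \<Rightarrow> 'b \<Rightarrow> 'e).
     (\<forall>i\<le>k. openin B (U i) \<and>
        continuous_map (subtopology B (U i)) E (s i) \<and>
        homotopic_with (\<lambda>_. True) (subtopology B (U i)) B (p \<circ> s i) id) \<and>
     (\<Union>i\<le>k. U i) = topspace B}"

definition TC :: "'c topology \<Rightarrow> enat" where
  "TC Z = secat (path_space Z) (prod_topology Z Z) (\<lambda>\<gamma>. (\<gamma> 0, \<gamma> 1))"

text \<open>The common target of \<open>f\<close> and \<open>g\<close> enters \<open>\<Delta>\<close> only through the equation \<open>f \<circ> \<alpha> = g \<circ> \<beta>\<close>.\<close>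

definition Delta_space ::
  "'a topology \<Rightarrow> 'b topology \<Rightarrow> ('a \<Rightarrow> 'c) \<Rightarrow> ('b \<Rightarrow> 'c) \<Rightarrow> ((real \<Rightarrow> 'a) \<times> (real \<Rightarrow> 'b)) topology" where
  "Delta_space X Y f g = subtopology (prod_topology (path_space X) (path_space Y))
     {(\<alpha>, \<beta>). \<forall>t\<in>{0..1}. f (\<alpha> t) = g (\<beta> t)}"

definition bivariate_TC ::
  "'a topology \<Rightarrow> 'b topology \<Rightarrow> ('a \<Rightarrow> 'c) \<Rightarrow> ('b \<Rightarrow> 'c) \<Rightarrow> enat" where
  "bivariate_TC X Y f g =
     sec (Delta_space X Y f g) (prod_topology X Y) (\<lambda>(\<alpha>, \<beta>). (\<alpha> 0, \<beta> 1))"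

end

theory Submission
  imports Defs
begin

text \<open>
  Sections compose. Let \<open>U\<^sub>i\<close> cover \<open>Z \<times> Z\<close> with local sections \<open>s\<^sub>i\<close> of \<open>f \<times> g\<close>, and let
  \<open>V\<^sub>j\<close> cover \<open>X \<times> Y\<close> with local sections \<open>(\<alpha>\<^sub>j, \<beta>\<^sub>j)\<close> of \<open>\<Delta> \<rightarrow> X \<times> Y\<close>. The pair
  \<open>(\<alpha>\<^sub>j, \<beta>\<^sub>j)\<close> over \<open>(x, y)\<close> satisfies \<open>\<alpha>\<^sub>j(0) = x\<close>, \<open>\<beta>\<^sub>j(1) = y\<close> and \<open>f \<circ> \<alpha>\<^sub>j = g \<circ> \<beta>\<^sub>j\<close>, so
  \<open>f \<circ> \<alpha>\<^sub>j\<close> is a path from \<open>f(x)\<close> to \<open>g(y)\<close>. Hence \<open>f \<circ> \<alpha>\<^sub>j \<circ> s\<^sub>i\<close> is a strict local section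
  of the path fibration of \<open>Z\<close> over \<open>U\<^sub>i \<inter> s\<^sub>i\<inverse>(V\<^sub>j)\<close>, and these open sets cover \<open>Z \<times> Z\<close>.

  In other words, post-composition with \<open>f\<close> on the first component lifts the composite
  \<open>\<Delta> \<rightarrow> X \<times> Y \<rightarrow> Z \<times> Z\<close> through the path space of \<open>Z\<close>
  (\<open>continuous_map_compact_open_postcompose\<close>), the numbers \<open>sec + 1\<close> are submultiplicative under
  composition of maps (\<open>sec_compose_le\<close>), and a map \<open>E \<rightarrow> E'\<close> over \<open>B\<close> carries sections to sections
  (\<open>sec_le_over_base\<close>). A strict section is in particular one up to homotopy (\<open>secat_le_sec\<close>).
\<close>

text \<open>
  An open cover \<open>U\<^sub>0, \<dots>, U\<^sub>k\<close> of \<open>B\<close> by \<open>k + 1\<close> sets with strict local sections \<open>s\<^sub>i\<close> of \<open>p\<close>.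
  The values of \<open>U\<close> and \<open>s\<close> at indices above \<open>k\<close> are irrelevant.
\<close>

definition section_cover :: "'e topology \<Rightarrow> 'b topology \<Rightarrow> ('e \<Rightarrow> 'b) \<Rightarrow> nat
    \<Rightarrow> (nat \<Rightarrow> 'b set) \<Rightarrow> (nat \<Rightarrow> 'b \<Rightarrow> 'e) \<Rightarrow> bool" where
  "section_cover E B p k U s \<longleftrightarrow>
     (\<forall>i\<le>k. openin B (U i) \<and> continuous_map (subtopology B (U i)) E (s i) \<and>
        (\<forall>b\<in>U i. p (s i b) = b)) \<and>
     (\<Union>i\<le>k. U i) = topspace B"

lemma sec_eq_Inf_section_cover:
  "sec E B p = Inf {enat k | k. \<exists>U s. section_cover E B p k U s}"
  unfolding sec_def section_cover_def ..

lemma sec_le_of_section_cover: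
  assumes "section_cover E B p k U s"
  shows "sec E B p \<le> enat k"
  unfolding sec_eq_Inf_section_cover using assms by (intro Inf_lower) blast

lemma section_cover_of_sec:
  assumes "sec E B p = enat k"
  obtains U s where "section_cover E B p k U s"
proof -
  let ?S = "{enat k | k. \<exists>U s. section_cover E B p k U s}"
  have "?S \<noteq> {}"
    using assms by (auto simp: sec_eq_Inf_section_cover Inf_enat_def simp del: Collect_empty_eq)
  \<comment> \<open>\<^typ>\<open>enat\<close> is well-ordered, so the infimum of a nonempty set is attained.\<close>
  then obtain x where "x \<in> ?S"
    by blast
  then have "(LEAST x. x \<in> ?S) \<in> ?S"
    by (rule LeastI)
  then have "Inf ?S \<in> ?S"
    using \<open>?S \<noteq> {}\<close> unfolding Inf_enat_def by (simp only: if_False)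
  then show thesis
    using assms that by (auto simp: sec_eq_Inf_section_cover)
qed

lemma secat_le_sec: "secat E B p \<le> sec E B p"
  unfolding secat_def sec_def
proof (rule Inf_superset_mono, safe)
  fix k :: nat and U s
  assume cov: "\<forall>i\<le>k. openin B (U i) \<and> continuous_map (subtopology B (U i)) E (s i) \<and>
        (\<forall>b\<in>U i. p (s i b) = b)" "(\<Union>i\<le>k. U i) = topspace B"
  have "homotopic_with (\<lambda>_. True) (subtopology B (U i)) B (p \<circ> s i) id" if "i \<le> k" for i
  proof (rule homotopic_with_symD, rule homotopic_with_equal)
    show "continuous_map (subtopology B (U i)) B id"
      by (simp add: continuous_map_from_subtopology)
  qed (use cov that in auto)
  then show "\<exists>k'. enat k = enat k' \<and> (\<exists>U s.
       (\<forall>i\<le>k'. openin B (U i) \<and> continuous_map (subtopology B (U i)) E (s i) \<and>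
          homotopic_with (\<lambda>_. True) (subtopology B (U i)) B (p \<circ> s i) id) \<and>
       (\<Union>i\<le>k'. U i) = topspace B)"
    using cov by blast
qed

lemma sec_le_over_base:
  assumes "continuous_map E E' \<phi>" and "\<And>e. e \<in> topspace E \<Longrightarrow> p' (\<phi> e) = p e"
  shows "sec E' B p' \<le> sec E B p"
proof (cases "sec E B p")
  case (enat k)
  then obtain U s where cov: "section_cover E B p k U s"
    by (rule section_cover_of_sec)
  have "section_cover E' B p' k U (\<lambda>i. \<phi> \<circ> s i)"
    unfolding section_cover_def
  proof (intro conjI allI impI ballI)
    fix i assume i: "i \<le> k"
    then have s: "continuous_map (subtopology B (U i)) E (s i)" and U: "openin B (U i)"
      and ps: "\<And>b. b \<in> U i \<Longrightarrow> p (s i b) = b"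
      using cov by (auto simp: section_cover_def)
    show "openin B (U i)" by fact
    show "continuous_map (subtopology B (U i)) E' (\<phi> \<circ> s i)"
      using s assms(1) by (rule continuous_map_compose)
    fix b assume b: "b \<in> U i"
    then have "s i b \<in> topspace E"
      using s openin_subset[OF U] by (auto simp: continuous_map_def)
    then show "p' ((\<phi> \<circ> s i) b) = b"
      using assms(2) ps b by simp
  qed (use cov in \<open>simp add: section_cover_def\<close>)
  then show ?thesis
    using enat sec_le_of_section_cover by metis
qed simp

lemma sec_compose_le:
  "sec E C (q \<circ> p) + 1 \<le> (sec E B p + 1) * (sec B C q + 1)"
proof (cases "sec E B p = \<infinity> \<or> sec B C q = \<infinity>")
  case True
  then have "(sec E B p + 1) * (sec B C q + 1) = \<infinity>"
    by (auto simp: imult_is_infinity)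
  then show ?thesis by simp
next
  case False
  then obtain m n where m: "sec E B p = enat m" and n: "sec B C q = enat n"
    by auto
  obtain V t where V: "section_cover E B p m V t"
    using section_cover_of_sec[OF m] .
  obtain U s where U: "section_cover B C q n U s"
    using section_cover_of_sec[OF n] .
  \<comment> \<open>Pairs \<open>(i, j)\<close> with \<open>i \<le> n\<close> and \<open>j \<le> m\<close> are enumerated as \<open>i * (m + 1) + j\<close>.\<close>
  define d r where "d l = l div (m + 1)" and "r l = l mod (m + 1)" for l
  define k where "k = (m + 1) * (n + 1) - 1"
  have d: "d l \<le> n" if "l \<le> k" for l
  proof -
    have "l < (n + 1) * (m + 1)"
      using that by (simp add: k_def algebra_simps)
    then show ?thesis
      by (simp add: d_def div_less_iff_less_mult less_Suc_eq_le[symmetric] del: mult_Suc mult_Suc_right)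
  qed
  have r: "r l \<le> m" for l
    unfolding r_def by (simp add: less_Suc_eq_le[symmetric])
  define W where "W l = {c \<in> U (d l). s (d l) c \<in> V (r l)}" for l
  have "section_cover E C (q \<circ> p) k W (\<lambda>l. t (r l) \<circ> s (d l))"
    unfolding section_cover_def
  proof (intro conjI allI impI ballI)
    fix l assume "l \<le> k"
    with d have U': "openin C (U (d l))" and s: "continuous_map (subtopology C (U (d l))) B (s (d l))"
      and qs: "\<And>c. c \<in> U (d l) \<Longrightarrow> q (s (d l) c) = c"
      using U by (auto simp: section_cover_def)
    from r have V': "openin B (V (r l))" and t: "continuous_map (subtopology B (V (r l))) E (t (r l))"
      and pt: "\<And>b. b \<in> V (r l) \<Longrightarrow> p (t (r l) b) = b"
      using V by (auto simp: section_cover_def)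
    have "openin (subtopology C (U (d l))) (W l)"
      using openin_continuous_map_preimage[OF s V'] openin_subset[OF U']
      by (simp add: W_def Int_absorb1)
    then show "openin C (W l)"
      using U' openin_trans_full by blast
    have "continuous_map (subtopology C (W l)) B (s (d l))"
      using s by (rule continuous_map_from_subtopology_mono) (auto simp: W_def)
    then have "continuous_map (subtopology C (W l)) (subtopology B (V (r l))) (s (d l))"
      by (auto simp: continuous_map_in_subtopology W_def)
    then show "continuous_map (subtopology C (W l)) E (t (r l) \<circ> s (d l))"
      using t by (rule continuous_map_compose)
    fix c assume "c \<in> W l"
    then show "(q \<circ> p) ((t (r l) \<circ> s (d l)) c) = c"
      using pt qs by (simp add: W_def)
  next
    show "(\<Union>l\<le>k. W l) = topspace C"
    proof (intro subset_antisym subsetI)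
      fix c assume "c \<in> (\<Union>l\<le>k. W l)"
      then show "c \<in> topspace C"
        using U d by (auto simp: W_def section_cover_def)
    next
      fix c assume c: "c \<in> topspace C"
      moreover have "(\<Union>i\<le>n. U i) = topspace C"
        using U by (simp add: section_cover_def)
      ultimately obtain i where i: "i \<le> n" "c \<in> U i"
        by blast
      have "s i c \<in> topspace B"
        using U c i by (auto simp: section_cover_def continuous_map_def)
      moreover have "(\<Union>j\<le>m. V j) = topspace B"
        using V by (simp add: section_cover_def)
      ultimately obtain j where j: "j \<le> m" "s i c \<in> V j"
        by blast
      have "i * (m + 1) + j \<le> n * (m + 1) + m"
        using i(1) j(1) by (intro add_mono mult_le_mono1)
      then have "i * (m + 1) + j \<le> k"
        by (simp add: k_def algebra_simps)
      moreover have "d (i * (m + 1) + j) = i" "r (i * (m + 1) + j) = j"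
        using j(1) by (simp_all add: d_def r_def del: mult_Suc mult_Suc_right)
      then have "c \<in> W (i * (m + 1) + j)"
        using i j by (simp add: W_def)
      ultimately show "c \<in> (\<Union>l\<le>k. W l)" by blast
    qed
  qed
  then have "sec E C (q \<circ> p) \<le> enat k"
    by (rule sec_le_of_section_cover)
  then have "sec E C (q \<circ> p) + 1 \<le> enat k + 1"
    by (rule add_right_mono)
  also have "\<dots> = (sec E B p + 1) * (sec B C q + 1)"
    by (simp add: m n k_def one_enat_def)
  finally show ?thesis .
qed

text \<open>The composite is restricted because points of the function space are extensional.\<close>

lemma continuous_map_compact_open_postcompose:
  assumes f: "continuous_map X Z f"
  shows "continuous_map (compact_open_topology T X) (compact_open_topology T Z)
     (\<lambda>h. restrict (f \<circ> h) (topspace T))"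
    (is "continuous_map ?P ?Q ?F")
proof -
  have F: "continuous_map T Z (?F h)" if "continuous_map T X h" for h
    using continuous_map_compose[OF that f] by (rule continuous_map_eq) simp
  have "openin ?P (?F -` S \<inter> topspace ?P)"
    if S: "S = {h. h \<in> extensional (topspace T) \<and> continuous_map T Z h \<and> h ` K \<subseteq> U}"
      and K: "compactin T K" and U: "openin Z U" for S K U
  proof -
    let ?V = "{x \<in> topspace X. f x \<in> U}"
    have "openin X ?V"
      using f U by (rule openin_continuous_map_preimage)
    then have "openin ?P {h. h \<in> extensional (topspace T) \<and> continuous_map T X h \<and> h ` K \<subseteq> ?V}"
      unfolding compact_open_topology_def using K by (intro topology_generated_by_Basis) blast
    moreover have "?F -` S \<inter> topspace ?P =
        {h. h \<in> extensional (topspace T) \<and> continuous_map T X h \<and> h ` K \<subseteq> ?V}"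
    proof -
      have "?F h \<in> S \<longleftrightarrow> h ` K \<subseteq> ?V" if h: "continuous_map T X h" for h
        using F[OF h] compactin_subset_topspace[OF K] h
        by (auto simp: S image_subset_iff subset_iff continuous_map_def)
      then show ?thesis
        by (auto simp: topspace_compact_open_topology)
    qed
    ultimately show ?thesis by simp
  qed
  then show ?thesis
    unfolding compact_open_topology_def[of T Z]
    by (intro continuous_on_generated_topo)
      (auto simp: compact_open_topology_def[of T Z, symmetric]
         topology_generated_by_topspace[symmetric] topspace_compact_open_topology
         intro: continuous_map_compose[OF _ f])
qed

theorem proposition2p14:
  fixes X :: "'a topology" and Y :: "'b topology" and Z :: "'c topology"
    and f :: "'a \<Rightarrow> 'c" and g :: "'b \<Rightarrow> 'c"
  assumes "continuous_map X Z f" and "continuous_map Y Z g"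
  shows "(bivariate_TC X Y f g + 1) *
      (sec (prod_topology X Y) (prod_topology Z Z) (map_prod f g) + 1) \<ge> TC Z + 1"
proof -
  let ?ends = "\<lambda>(\<alpha> :: real \<Rightarrow> 'a, \<beta> :: real \<Rightarrow> 'b). (\<alpha> 0, \<beta> 1)"
  let ?\<phi> = "\<lambda>(\<alpha> :: real \<Rightarrow> 'a, \<beta> :: real \<Rightarrow> 'b). restrict (f \<circ> \<alpha>) {0..1}"
  have "continuous_map (Delta_space X Y f g) (path_space X) fst"
    unfolding Delta_space_def
    by (intro continuous_map_from_subtopology continuous_map_fst)
  then have "continuous_map (Delta_space X Y f g) (path_space Z)
      ((\<lambda>h. restrict (f \<circ> h) (topspace (top_of_set {0..1}))) \<circ> fst)"
    by (rule continuous_map_compose) (rule continuous_map_compact_open_postcompose[OF assms(1)])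
  then have \<phi>: "continuous_map (Delta_space X Y f g) (path_space Z) ?\<phi>"
    by (simp add: comp_def case_prod_unfold)
  \<comment> \<open>The end point is \<open>f (\<alpha> 1) = g (\<beta> 1)\<close> by the definition of \<open>\<Delta>\<close>.\<close>
  have over: "(?\<phi> e 0, ?\<phi> e 1) = (map_prod f g \<circ> ?ends) e"
    if "e \<in> topspace (Delta_space X Y f g)" for e
    using that by (auto simp: Delta_space_def)
  have "TC Z \<le> sec (path_space Z) (prod_topology Z Z) (\<lambda>\<gamma>. (\<gamma> 0, \<gamma> 1))"
    unfolding TC_def by (rule secat_le_sec)
  also have "\<dots> \<le> sec (Delta_space X Y f g) (prod_topology Z Z) (map_prod f g \<circ> ?ends)"
    using sec_le_over_base[where p' = "\<lambda>\<gamma>. (\<gamma> 0, \<gamma> 1)", OF \<phi> over] .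
  finally have "TC Z + 1 \<le> sec (Delta_space X Y f g) (prod_topology Z Z) (map_prod f g \<circ> ?ends) + 1"
    by (rule add_right_mono)
  also have "\<dots> \<le> (bivariate_TC X Y f g + 1) *
      (sec (prod_topology X Y) (prod_topology Z Z) (map_prod f g) + 1)"
    unfolding bivariate_TC_def by (rule sec_compose_le)
  finally show ?thesis .
qed

end
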